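(* Let $n$ be a positive integer and suppose $2n^2+2n+1=mv$ where $m$ is a positive integer and $v$ is a prime with $v>2n+1$. Let $a=\min\{a\in\mathbb{Z}^+: v\mid 4^a+4n+2\}$ (with $a=\infty$ if no such positive integer exists) and let $b$ be the multiplicative order of $4$ modulo $v$. If there exists a linear $PL(n,2)$-code, then there exists $\ell\in\{0,1,\dots,\lfloor m/4\rfloor\}$ such that the equation $a(x+1)+by=n-\ell$ has a solution in nonnegative integers $x,y$.
   Context: The Lee sphere of radius $r$ in $\mathbb{Z}^n$ is $S(n,r)=\{x\in\mathbb{Z}^n: |x_1|+\dots+|x_n|\le r\}$. A linear $PL(n,r)$-code is a subgroup (lattice) $C\subseteq\mathbb{Z}^n$ such that the translates $\{S(n,r)+c: c\in C\}$ form a partition of $\mathbb{Z}^n$. When $a=\infty$, the equation $a(x+1)+by=n-\ell$ is understood to have no solutions. *)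

theory Defs
  imports
    "HOL-Algebra.Product_Groups"
    "HOL-Number_Theory.Pocklington"
    "HOL-Library.Disjoint_Sets"
    "HOL-Library.Extended_Nat"
begin

(* Elements are integer-valued functions on {1..n}, extended by undefined outside {1..n}. *)
definition Zn :: "nat \<Rightarrow> (nat \<Rightarrow> int) monoid" where
  "Zn n = product_group {1..n} (\<lambda>_. integer_group)"

definition lee_sphere :: "nat \<Rightarrow> nat \<Rightarrow> (nat \<Rightarrow> int) set" where
  "lee_sphere n r = {x \<in> carrier (Zn n). (\<Sum>i=1..n. \<bar>x i\<bar>) \<le> int r}"

(* The translates are collected as a set of sets.  No multiplicity is lost this way: the sphere is
   finite and nonempty, so distinct c give distinct translates. *)
definition linear_PL_code :: "nat \<Rightarrow> nat \<Rightarrow> (nat \<Rightarrow> int) set \<Rightarrow> bool" where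
  "linear_PL_code n r C \<longleftrightarrow>
     subgroup C (Zn n) \<and>
     partition_on (carrier (Zn n)) ((\<lambda>c. lee_sphere n r #>\<^bsub>Zn n\<^esub> c) ` C)"

end

theory Submission
  imports
    Defs
    "HOL-Algebra.Sylow"
    "HOL-Computational_Algebra.Formal_Power_Series"
begin

text \<open>
  A linear code \<open>C\<close> tiling with the sphere \<open>B\<close> makes \<open>B\<close> a transversal of \<open>\<int>\<^sup>n / C\<close>, so \<open>v\<close> divides the order
  of this quotient and there is an epimorphism onto \<open>\<int> / v\<close>. Let \<open>x\<^sub>i\<close> be the images of the unit
  vectors. Each residue is hit equally often by \<open>B\<close>, so the power sums over the image of \<open>B\<close> with small
  even exponent \<open>2k\<close> vanish modulo \<open>v\<close>. Written in terms of \<open>S\<^sub>k = \<Sum> x\<^sub>i\<^bsup>2k\<^esup>\<close> this is the relation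
  \<open>(4\<^bsup>k\<^esup> + 4n + 2) S\<^sub>k + 2 \<Sum>\<^bsub>0 < s < k\<^esub> (2k choose 2s) S\<^sub>s S\<^bsub>k-s\<^esub> \<equiv> 0\<close>. Hence \<open>S\<^sub>k\<close> can be nonzero only if \<open>k\<close> is a
  sum of exponents \<open>j\<close> with \<open>v dvd 4\<^bsup>j\<^esup> + 4n + 2\<close>, that is, of numbers \<open>a + by\<close>. By Newton's identities the
  same holds for the elementary symmetric functions of the \<open>x\<^sub>i\<^sup>2\<close>. If \<open>l\<close> of the \<open>x\<^sub>i\<close> vanish, the one of
  degree \<open>n - l\<close> is a product of nonzero residues. Finally the fibre of \<open>0\<close> in \<open>B\<close> has \<open>m\<close> elements and
  contains the origin and \<open>4l\<close> multiples of unit vectors, so \<open>4l < m\<close>.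
\<close>

section \<open>Homomorphisms from finite abelian groups to prime cyclic groups\<close>

text \<open>The set is the join of \<open>H\<close> with the cyclic group of \<open>g\<close>;
  maximality of a subgroup \<open>H\<close> is later tested against it.\<close>

lemma (in comm_group) subgroup_multiples:
  assumes H: "subgroup H G" and g: "g \<in> carrier G"
  shows "subgroup {q \<in> carrier G. \<exists>k::int. q \<otimes> g [^] k \<in> H} G"
proof (rule subgroupI)
  interpret H: subgroup H G by fact
  show "{q \<in> carrier G. \<exists>k::int. q \<otimes> g [^] k \<in> H} \<noteq> {}"
    using g by (auto intro!: exI[of _ \<one>] exI[of _ 0])
  fix q assume "q \<in> {q \<in> carrier G. \<exists>k::int. q \<otimes> g [^] k \<in> H}"
  then obtain k :: int where q: "q \<in> carrier G" "q \<otimes> g [^] k \<in> H" by auto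
  have "inv (q \<otimes> g [^] k) = inv q \<otimes> g [^] (- k)"
    using q g by (simp add: inv_mult int_pow_neg)
  then show "inv q \<in> {q \<in> carrier G. \<exists>k::int. q \<otimes> g [^] k \<in> H}"
    using q H.m_inv_closed[OF q(2)] by auto
  fix q' assume "q' \<in> {q \<in> carrier G. \<exists>k::int. q \<otimes> g [^] k \<in> H}"
  then obtain k' :: int where q': "q' \<in> carrier G" "q' \<otimes> g [^] k' \<in> H" by auto
  have "(q \<otimes> g [^] k) \<otimes> (q' \<otimes> g [^] k') = (q \<otimes> q') \<otimes> g [^] (k + k')"
    using q q' g by (simp add: int_pow_mult m_ac)
  then show "q \<otimes> q' \<in> {q \<in> carrier G. \<exists>k::int. q \<otimes> g [^] k \<in> H}"
    using q q' H.m_closed[OF q(2) q'(2)] by auto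
qed auto

text \<open>By Cauchy's theorem the \<open>p\<close>-th power map has a nontrivial kernel, so on a
  finite group it is not onto. Its cokernel is a nontrivial elementary abelian
  \<open>p\<close>-group, and such a group has a quotient of order \<open>p\<close>.\<close>

lemma (in comm_group) epi_integer_mod_group:
  assumes fin: "finite (carrier G)" and p: "prime p" and dvd: "p dvd order G"
  shows "\<exists>f \<in> hom G (integer_mod_group p). f ` carrier G = carrier (integer_mod_group p)"
proof -
  define K where "K = (\<lambda>x. x [^] p) ` carrier G"
  have hom: "(\<lambda>x. x [^] p) \<in> hom G G"
    by (auto simp: hom_def nat_pow_distrib)
  interpret P: group_hom G G "\<lambda>x. x [^] p"
    by unfold_locales (fact hom)
  have K: "subgroup K G"
    unfolding K_def by (rule P.img_is_subgroup)
  have "K \<noteq> carrier G"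
  proof
    assume "K = carrier G"
    then have "inj_on (\<lambda>x. x [^] p) (carrier G)"
      using fin unfolding K_def by (simp add: finite_surj_inj)
    moreover obtain H where H: "subgroup H G" "card H = p"
    proof -
      \<comment> \<open>Sylow's theorem with exponent 1, where \<open>m\<close> may still be
        divisible by \<open>p\<close>, is Cauchy's theorem.\<close>
      obtain m where "order G = p ^ 1 * m" using dvd by auto
      from sylow_thm[OF p is_group this fin] show ?thesis using that by auto
    qed
    interpret H: subgroup H G by fact
    obtain h where h: "h \<in> H" "h \<noteq> \<one>"
    proof -
      have "\<not> H \<subseteq> {\<one>}"
        using card_mono[of "{\<one>}" H] H prime_gt_1_nat[OF p] by auto
      then show ?thesis using that by auto
    qed
    have "h [^] p = \<one>"
    proof -
      have "group (G\<lparr>carrier := H\<rparr>)" using H(1) by (rule subgroup.subgroup_is_group) (rule is_group)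
      then have "h [^]\<^bsub>G\<lparr>carrier := H\<rparr>\<^esub> order (G\<lparr>carrier := H\<rparr>) = \<one>"
        using group.pow_order_eq_1 h by fastforce
      then show ?thesis using H using nat_pow_consistent[of h p H] by (simp add: order_def)
    qed
    ultimately show False
      using h H.mem_carrier[OF h(1)] inj_onD[of "\<lambda>x. x [^] p" "carrier G" h \<one>] by simp
  qed
  txt \<open>The map is the quotient by a maximal proper subgroup \<open>H\<close> above the subgroup \<open>K\<close> of \<open>p\<close>-th powers,
    with the coset of some \<open>g \<notin> H\<close> as generator.\<close>
  define \<H> where "\<H> = {H. subgroup H G \<and> K \<subseteq> H \<and> H \<noteq> carrier G}"
  have "finite \<H>"
    by (rule finite_subset[of _ "Pow (carrier G)"]) (auto simp: \<H>_def fin dest: subgroup.subset)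
  moreover have "K \<in> \<H>" using K \<open>K \<noteq> carrier G\<close> by (simp add: \<H>_def)
  ultimately obtain H where "H \<in> \<H>" and max: "\<And>H'. H' \<in> \<H> \<Longrightarrow> H \<subseteq> H' \<Longrightarrow> H = H'"
    using finite_has_maximal[of \<H>] by auto
  then have H: "subgroup H G" "K \<subseteq> H" "H \<noteq> carrier G" by (auto simp: \<H>_def)
  interpret H: subgroup H G by fact
  obtain g where g: "g \<in> carrier G" "g \<notin> H" using H(3) H.subset by auto
  \<comment> \<open>\<open>R q k\<close> puts \<open>q\<close> in the coset of
    \<open>g [^] (- k)\<close>: modulo \<open>H\<close>, \<open>k\<close> is minus the discrete
    logarithm of \<open>q\<close>, whence the sign in \<open>f\<close> below.\<close>
  define R where "R q k \<longleftrightarrow> q \<otimes> g [^] k \<in> H" for q and k :: int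
  have R_mult: "R (q \<otimes> q') (k + k')"
    if "q \<in> carrier G" "q' \<in> carrier G" "R q k" "R q' k'" for q q' k k'
  proof -
    have "(q \<otimes> g [^] k) \<otimes> (q' \<otimes> g [^] k') = (q \<otimes> q') \<otimes> g [^] (k + k')"
      using that g by (simp add: int_pow_mult m_ac)
    then show ?thesis using H.m_closed that by (metis R_def)
  qed
  have R_ex: "\<exists>k. R q k" if "q \<in> carrier G" for q
  proof -
    let ?H' = "{q \<in> carrier G. \<exists>k::int. q \<otimes> g [^] k \<in> H}"
    have "subgroup ?H' G" using H(1) g(1) by (rule subgroup_multiples)
    moreover have "H \<subseteq> ?H'"
      using H.subset by (auto intro!: exI[of _ 0])
    moreover have "g \<in> ?H'"
      using g by (auto intro!: exI[of _ "-1"] simp: int_pow_neg)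
    ultimately have "?H' = carrier G"
      using max[of ?H'] H g by (auto simp: \<H>_def)
    then show ?thesis using that by (auto simp: R_def)
  qed
  have pow_p: "g [^] (int p * k) \<in> H" for k :: int
  proof -
    have "g [^] (int p * k) = (g [^] k) [^] p"
      using int_pow_pow[OF g(1), of k "int p"] by (simp add: int_pow_int mult.commute)
    moreover have "(g [^] k) [^] p \<in> K" unfolding K_def using g(1) by (intro imageI) simp
    ultimately show ?thesis using H(2) by auto
  qed
  have pow_iff: "g [^] k \<in> H \<longleftrightarrow> int p dvd k" for k :: int
  proof
    assume k: "g [^] k \<in> H"
    show "int p dvd k"
    proof (rule ccontr)
      \<comment> \<open>Otherwise Bezout writes \<open>g\<close> as a product of powers of
        \<open>g [^] p\<close> and \<open>g [^] k\<close>, both in \<open>H\<close>.\<close>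
      assume "\<not> int p dvd k"
      then have "coprime (int p) k" using p by (simp add: prime_imp_coprime)
      then obtain u w where uw: "u * int p + w * k = 1"
        by (metis bezout_int coprime_iff_gcd_eq_1)
      have "g = g [^] (int p * u) \<otimes> (g [^] k) [^] w"
      proof -
        have "(g [^] k) [^] w = g [^] (k * w)" using g by (simp add: int_pow_pow)
        moreover have "int p * u + k * w = 1" using uw by (simp add: mult.commute)
        ultimately show ?thesis using g int_pow_mult[of g "int p * u" "k * w"] by simp
      qed
      also have "\<dots> \<in> H" using pow_p k H by (simp add: subgroup_int_pow_closed)
      finally show False using g by simp
    qed
  qed (use pow_p in auto)
  have R_unique: "k mod int p = k' mod int p" if "R q k" "R q k'" "q \<in> carrier G" for q k k'
  proof -
    have "(q \<otimes> g [^] k) \<otimes> inv (q \<otimes> g [^] k') = (q \<otimes> inv q) \<otimes> (g [^] k \<otimes> inv (g [^] k'))"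
      using that(3) g(1) by (simp only: inv_mult m_ac int_pow_closed inv_closed m_closed)
    then have "g [^] (k - k') = (q \<otimes> g [^] k) \<otimes> inv (q \<otimes> g [^] k')"
      using that(3) g(1) by (simp add: int_pow_diff)
    also have "\<dots> \<in> H" using that by (simp add: R_def)
    finally show ?thesis by (simp add: pow_iff mod_eq_dvd_iff)
  qed
  define f where "f q = (- (SOME k. R q k)) mod int p" for q
  have f_eq: "f q = (- k) mod int p" if "R q k" "q \<in> carrier G" for q k
  proof -
    have "R q (SOME k. R q k)" using that by (auto intro: someI)
    from R_unique[OF this that] show ?thesis unfolding f_def by (metis mod_minus_cong)
  qed
  have p0: "p > 0" using p by (simp add: prime_gt_0_nat)
  show ?thesis
  proof (intro bexI[of _ f] homI equalityI subsetI)
    fix q q' assume q: "q \<in> carrier G" "q' \<in> carrier G"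
    then obtain k k' where k: "R q k" "R q' k'" using R_ex by metis
    show "f (q \<otimes> q') = f q \<otimes>\<^bsub>integer_mod_group p\<^esub> f q'"
      using f_eq[OF R_mult[OF q k]] q k by (simp add: f_eq) (simp add: mod_simps)
  next
    fix t assume t: "t \<in> carrier (integer_mod_group p)"
    then have t: "0 \<le> t" "t < int p" using p0 by (auto simp: carrier_integer_mod_group)
    have "R (g [^] t) (- t)" using g(1) by (simp add: R_def int_pow_neg)
    from f_eq[OF this] have "f (g [^] t) = t" using g t by simp
    then show "t \<in> f ` carrier G" using g by (metis imageI int_pow_closed)
  qed (use p0 in \<open>auto simp: carrier_integer_mod_group f_def\<close>)
qed

section \<open>Fibre sizes and shift-invariant power sums\<close>

lemma (in group_hom) card_kernel_mult_order:
  assumes "h ` carrier G = carrier H"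
  shows "card (kernel G H h) * order H = order G"
proof -
  have "bij_betw (\<lambda>X. the_elem (h ` X)) (carrier (G Mod kernel G H h)) (carrier H)"
    using FactGroup_inj_on FactGroup_onto[OF assms] by (simp add: bij_betw_def)
  then have "card (rcosets (kernel G H h)) = order H"
    by (auto dest: bij_betw_same_card simp: FactGroup_def order_def)
  then show ?thesis
    using G.lagrange[OF subgroup_kernel] by (simp add: mult.commute)
qed

text \<open>In the application \<open>\<tau>\<close> is translation in the quotient by the code. The
  bound on \<open>j\<close> keeps the coefficient \<open>Suc j\<close> invertible modulo
  \<open>p\<close>.\<close>

lemma prime_dvd_power_sum:
  fixes \<phi> :: "'a \<Rightarrow> int"
  assumes p: "prime p" and fin: "finite A" and bij: "bij_betw \<tau> A A"
    and shift: "\<And>q. q \<in> A \<Longrightarrow> [\<phi> (\<tau> q) = \<phi> q + 1] (mod int p)"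
    and card: "p dvd card A"
  shows "j + 1 < p \<Longrightarrow> int p dvd (\<Sum>q\<in>A. \<phi> q ^ j)"
proof (induction j rule: less_induct)
  case (less j)
  define T where "T i = (\<Sum>q\<in>A. \<phi> q ^ i)" for i
  txt \<open>The sum of the powers with exponent \<open>j + 1\<close> is invariant under the shift; after expanding, its
    leading term cancels and the term with \<open>T j\<close> is the only one not covered by induction.\<close>
  have "T (Suc j) = (\<Sum>q\<in>A. \<phi> (\<tau> q) ^ Suc j)"
    unfolding T_def by (rule sum.reindex_bij_betw[OF bij, symmetric])
  also have "[\<dots> = (\<Sum>q\<in>A. (\<phi> q + 1) ^ Suc j)] (mod int p)"
    by (intro cong_sum cong_pow shift)
  also have "(\<Sum>q\<in>A. (\<phi> q + 1) ^ Suc j) = (\<Sum>i\<le>Suc j. int (Suc j choose i) * T i)"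
    unfolding binomial_ring T_def sum_distrib_left by (subst sum.swap) simp
  also have "\<dots> = T (Suc j) + int (Suc j) * T j + (\<Sum>i<j. int (Suc j choose i) * T i)"
    by (simp add: lessThan_Suc_atMost[symmetric] del: lessThan_Suc_atMost)
  finally have "[T (Suc j) + 0 = T (Suc j) + (int (Suc j) * T j + (\<Sum>i<j. int (Suc j choose i) * T i))] (mod int p)"
    by (simp add: add.assoc)
  then have "int p dvd int (Suc j) * T j + (\<Sum>i<j. int (Suc j choose i) * T i)"
    by (metis cong_add_lcancel cong_0_iff cong_sym)
  moreover have "int p dvd (\<Sum>i<j. int (Suc j choose i) * T i)"
    using less by (intro dvd_sum dvd_mult) (auto simp: T_def)
  ultimately have "int p dvd int (Suc j) * T j"
    by (simp add: dvd_add_left_iff)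
  moreover have "\<not> int p dvd int (Suc j)"
    using less.prems by (simp only: int_dvd_int_iff) (auto dest: dvd_imp_le)
  ultimately show ?case
    using p by (auto simp: T_def prime_dvd_mult_iff)
qed

section \<open>Newton's identities modulo a prime\<close>

unbundle fps_syntax

text \<open>This is the logarithmic derivative of \<open>P\<close> with denominators cleared: each
  linear factor contributes the geometric series of \<open>y i\<close>, which starts in degree
  1.\<close>

lemma Newton_identity_fps:
  fixes y :: "'i \<Rightarrow> 'a :: comm_ring_1"
  assumes "finite A"
  defines "P \<equiv> \<Prod>i\<in>A. (1 - fps_const (y i) * fps_X)"
  shows "fps_X * fps_deriv P = - P * Abs_fps (\<lambda>k. if k = 0 then 0 else \<Sum>i\<in>A. y i ^ k)"
  using assms(1) unfolding P_def
proof (induction A)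
  case empty
  then show ?case by (simp add: fps_eq_iff)
next
  case (insert j A)
  define P where "P = (\<Prod>i\<in>A. (1 - fps_const (y i) * fps_X))"
  define F where "F = Abs_fps (\<lambda>k. if k = 0 then 0 else \<Sum>i\<in>A. y i ^ k)"
  define G where "G = Abs_fps (\<lambda>k. if k = 0 then 0 else y j ^ k)"
  \<comment> \<open>The geometric series formula in a form that needs no inverse.\<close>
  have G: "(1 - fps_const (y j) * fps_X) * G = fps_const (y j) * fps_X"
  proof (rule fps_ext)
    fix k show "((1 - fps_const (y j) * fps_X) * G) $ k = (fps_const (y j) * fps_X) $ k"
      by (cases k) (auto simp: left_diff_distrib mult.assoc G_def fps_X_nth)
  qed
  have FG: "Abs_fps (\<lambda>k. if k = 0 then 0 else \<Sum>i\<in>insert j A. y i ^ k) = F + G"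
    using insert by (auto simp: F_def G_def fps_eq_iff)
  have "fps_X * fps_deriv ((1 - fps_const (y j) * fps_X) * P)
      = (1 - fps_const (y j) * fps_X) * (fps_X * fps_deriv P) - P * (fps_const (y j) * fps_X)"
    by (simp add: algebra_simps)
  also have "\<dots> = (1 - fps_const (y j) * fps_X) * (- P * F) - P * ((1 - fps_const (y j) * fps_X) * G)"
    by (simp only: insert.IH[folded P_def F_def] G)
  also have "\<dots> = - ((1 - fps_const (y j) * fps_X) * P) * (F + G)"
    by (simp add: algebra_simps)
  finally show ?case
    using insert by (simp add: FG P_def)
qed

text \<open>Up to sign \<open>P $ k\<close> is the elementary symmetric function of degree
  \<open>k\<close>; the identity compares coefficients.\<close>

lemma Newton_identity:
  fixes y :: "'i \<Rightarrow> 'a :: comm_ring_1"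
  assumes "finite A"
  defines "P \<equiv> \<Prod>i\<in>A. (1 - fps_const (y i) * fps_X)"
  shows "of_nat k * P $ k = - (\<Sum>s=1..k. (\<Sum>i\<in>A. y i ^ s) * P $ (k - s))"
proof -
  have "of_nat k * P $ k = (fps_X * fps_deriv P) $ k" by (cases k) auto
  also have "\<dots> = (- (Abs_fps (\<lambda>k. if k = 0 then 0 else \<Sum>i\<in>A. y i ^ k) * P)) $ k"
    using Newton_identity_fps[OF assms(1), of y] by (simp add: P_def mult.commute)
  also have "\<dots> = - (\<Sum>s=1..k. (\<Sum>i\<in>A. y i ^ s) * P $ (k - s))"
    by (simp add: fps_mult_nth sum.atLeast_Suc_atMost)
  finally show ?thesis .
qed

lemma fps_linear_prod_nth_card:
  fixes y :: "'i \<Rightarrow> 'a :: comm_ring_1"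
  assumes "finite A"
  shows "(\<Prod>i\<in>A. (1 - fps_const (y i) * fps_X)) $ card A = (\<Prod>i\<in>A. - y i)"
proof -
  \<comment> \<open>Vanishing above the degree is carried along because a new factor also picks up
    the coefficient just above the old degree.\<close>
  have "(\<Prod>i\<in>A. (1 - fps_const (y i) * fps_X)) $ card A = (\<Prod>i\<in>A. - y i) \<and>
     (\<forall>k>card A. (\<Prod>i\<in>A. (1 - fps_const (y i) * fps_X)) $ k = 0)"
    using assms
  proof (induction A)
    case (insert j A)
    have nth_Suc: "((1 - fps_const (y j) * fps_X) * Q) $ Suc k = Q $ Suc k - y j * Q $ k" for Q k
      by (simp add: left_diff_distrib mult.assoc)
    have "(\<Prod>i\<in>insert j A. (1 - fps_const (y i) * fps_X)) $ card (insert j A) = (\<Prod>i\<in>insert j A. - y i)"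
      using insert by (simp add: nth_Suc)
    moreover have "(\<Prod>i\<in>insert j A. (1 - fps_const (y i) * fps_X)) $ k = 0" if k: "k > card (insert j A)" for k
    proof (cases k)
      case (Suc k')
      then have "card A < k'" "card A < Suc k'" using k insert by auto
      then have "(\<Prod>i\<in>A. (1 - fps_const (y i) * fps_X)) $ k' = 0"
        "(\<Prod>i\<in>A. (1 - fps_const (y i) * fps_X)) $ Suc k' = 0" using insert.IH by blast+
      then show ?thesis using insert.hyps Suc by (simp add: nth_Suc)
    qed (use k in simp)
    ultimately show ?case by blast
  qed auto
  then show ?thesis by blast
qed

text \<open>\<open>R\<close> stands for an additive semigroup of degrees. Since \<open>k < p\<close>
  is invertible, Newton's identities pass membership from power sums to the coefficients of
  \<open>P\<close>. Factors with \<open>y i = 0\<close> equal 1, so the top coefficient is, up to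
  sign, the product of the nonzero \<open>y i\<close>.\<close>

lemma card_nonzero_of_power_sums:
  fixes y :: "'i \<Rightarrow> int"
  assumes p: "prime p" and fin: "finite A" and card: "card A < p"
    and R_add: "\<And>j k. R j \<Longrightarrow> R k \<Longrightarrow> R (j + k)"
    and R: "\<And>k. 0 < k \<Longrightarrow> k \<le> card A \<Longrightarrow> \<not> int p dvd (\<Sum>i\<in>A. y i ^ k) \<Longrightarrow> R k"
    and y: "\<And>i. i \<in> A \<Longrightarrow> int p dvd y i \<longleftrightarrow> y i = 0"
    and ne: "{i\<in>A. y i \<noteq> 0} \<noteq> {}"
  shows "R (card {i\<in>A. y i \<noteq> 0})"
proof -
  define B where "B = {i\<in>A. y i \<noteq> 0}"
  have B: "finite B" "B \<subseteq> A" using fin by (auto simp: B_def)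
  define P where "P = (\<Prod>i\<in>A. (1 - fps_const (y i) * fps_X))"
  have coeff: "R k" if "0 < k" "k \<le> card A" "\<not> int p dvd P $ k" for k
    using that
  proof (induction k rule: less_induct)
    case (less k)
    have "\<not> int p dvd int k"
      using less.prems card by (simp only: int_dvd_int_iff) (auto dest: dvd_imp_le)
    then have "\<not> int p dvd of_nat k * P $ k"
      using less.prems p by (auto simp: prime_dvd_mult_iff)
    then have "\<not> int p dvd (\<Sum>s=1..k. (\<Sum>i\<in>A. y i ^ s) * P $ (k - s))"
      unfolding P_def Newton_identity[OF fin] by simp
    then obtain s where s: "s \<in> {1..k}" "\<not> int p dvd (\<Sum>i\<in>A. y i ^ s) * P $ (k - s)"
      by (meson dvd_sum)
    then have "\<not> int p dvd (\<Sum>i\<in>A. y i ^ s)" "\<not> int p dvd P $ (k - s)" by auto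
    moreover from this have "R s" using R[of s] s less.prems by auto
    ultimately show ?case
      \<comment> \<open>If \<open>s = k\<close>, then \<open>R s\<close> is already the claim; the
        induction hypothesis covers only positive degrees.\<close>
      using less.IH[of "k - s"] less.prems s R_add[of s "k - s"]
      by (cases "s = k") auto
  qed
  have "P = (\<Prod>i\<in>B. (1 - fps_const (y i) * fps_X))"
    unfolding P_def using B by (intro prod.mono_neutral_right fin) (auto simp: B_def)
  then have "P $ card B = (\<Prod>i\<in>B. - y i)"
    using fps_linear_prod_nth_card[OF B(1)] by simp
  moreover have "\<not> int p dvd (\<Prod>i\<in>B. - y i)"
    using p B y by (auto simp: prime_dvd_prod_iff B_def)
  ultimately have "R (card B)"
    using coeff[of "card B"] ne B fin by (auto simp: B_def card_gt_0_iff intro: card_mono)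
  then show ?thesis by (simp add: B_def)
qed

section \<open>The exponents generated by a and b\<close>

text \<open>At least one copy of \<open>a\<close> is required. Hence nothing is generated when
  \<open>a\<close> is infinite, whereas the product of infinity and 0 would be 0.\<close>

definition lee_generated :: "enat \<Rightarrow> nat \<Rightarrow> nat \<Rightarrow> bool" where
  "lee_generated a b k \<longleftrightarrow> (\<exists>x y. a * enat (x + 1) + enat (b * y) = enat k)"

lemma lee_generated_add:
  assumes "lee_generated a b j" "lee_generated a b k"
  shows "lee_generated a b (j + k)"
proof (cases a)
  case (enat a')
  from assms obtain x y x' y' where "j = a' * (x + 1) + b * y" "k = a' * (x' + 1) + b * y'"
    by (auto simp: lee_generated_def enat)
  then have "a' * ((x + x' + 1) + 1) + b * (y + y') = j + k"
    by (simp add: algebra_simps)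
  then have "a * enat ((x + x' + 1) + 1) + enat (b * (y + y')) = enat (j + k)"
    unfolding enat by simp
  then show ?thesis unfolding lee_generated_def by blast
qed (use assms in \<open>simp add: lee_generated_def\<close>)

text \<open>Two exponents with the divisibility give congruent powers of 4 modulo the odd
  \<open>v\<close>; cancelling the smaller one shows that they differ by a multiple of the order of
  4.\<close>

lemma lee_generated_if_dvd:
  fixes v n k :: nat
  assumes v: "odd v" and k: "k > 0" "v dvd 4 ^ k + 4 * n + 2"
  defines "a \<equiv> (INF k\<in>{k::nat. k > 0 \<and> v dvd 4 ^ k + 4 * n + 2}. enat k)"
  shows "lee_generated a (ord v 4) k"
proof -
  define Q where "Q k \<longleftrightarrow> k > 0 \<and> v dvd 4 ^ k + 4 * n + 2" for k
  define a' where "a' = (LEAST k. Q k)"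
  have Q: "Q k" using k by (simp add: Q_def)
  have a': "Q a'" unfolding a'_def using Q by (rule LeastI)
  have le: "a' \<le> j" if "Q j" for j unfolding a'_def using that by (rule Least_le)
  have "a = (INF k\<in>Collect Q. enat k)" by (simp only: a_def Q_def[abs_def])
  also have "\<dots> = enat a'"
    by (rule antisym) (use a' le in \<open>auto intro!: INF_lower INF_greatest\<close>)
  finally have a: "a = enat a'" .
  have "coprime v 4"
    using v by (metis coprime_commute coprime_left_2_iff_odd coprime_mult_left_iff numeral_Bit0 mult_2 numeral_times_numeral semiring_norm(13) semiring_norm(12))
  have "[4 ^ k + (4 * n + 2) = 4 ^ a' + (4 * n + 2)] (mod v)"
    using Q a' by (simp add: Q_def cong_def mod_eq_0_iff_dvd add.assoc)
  then have "[4 ^ a' * 4 ^ (k - a') = 4 ^ a' * 1] (mod v)"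
    using le[OF Q] by (simp only: cong_add_rcancel_nat flip: power_add) simp
  moreover have "coprime (4 ^ a') v"
    using \<open>coprime v 4\<close> by (simp add: coprime_commute)
  ultimately have "[4 ^ (k - a') = 1] (mod v)"
    using cong_mult_lcancel_nat by blast
  then obtain y where "k - a' = ord v 4 * y"
    by (auto simp only: ord_divides elim: dvdE)
  then have "k = a' * (0 + 1) + ord v 4 * y" using le[OF Q] by simp
  then have "a * enat (0 + 1) + enat (ord v 4 * y) = enat k" by (simp add: a)
  then show ?thesis unfolding lee_generated_def by blast
qed

section \<open>The Lee sphere of radius 2\<close>

text \<open>Scalar multiples are included. An index outside \<open>{1..n}\<close> gives the neutral
  element, so closure and additivity need no side condition.\<close>

definition unit_vec :: "nat \<Rightarrow> nat \<Rightarrow> int \<Rightarrow> nat \<Rightarrow> int" where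
  "unit_vec n i \<sigma> = (\<lambda>k\<in>{1..n}. if k = i then \<sigma> else 0)"

lemma Zn_simps [simp]:
  "carrier (Zn n) = (\<Pi>\<^sub>E i\<in>{1..n}. UNIV)"
  "x \<otimes>\<^bsub>Zn n\<^esub> y = (\<lambda>i\<in>{1..n}. x i + y i)"
  "\<one>\<^bsub>Zn n\<^esub> = (\<lambda>i\<in>{1..n}. 0)"
  by (simp_all add: Zn_def)

lemma Zn_comm_group: "comm_group (Zn n)"
proof -
  have "group (Zn n)" unfolding Zn_def by (rule product_group) auto
  then show ?thesis
    by (rule group.group_comm_groupI) (auto simp: add.commute)
qed

lemma unit_vec_carrier [simp]: "unit_vec n i \<sigma> \<in> carrier (Zn n)"
  by (auto simp: unit_vec_def)

lemma unit_vec_add: "unit_vec n i \<sigma> \<otimes>\<^bsub>Zn n\<^esub> unit_vec n i \<tau> = unit_vec n i (\<sigma> + \<tau>)"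
  by (auto simp: unit_vec_def)

text \<open>The points are sorted by the size of their support: norm at most 2 allows at most two
  nonzero coordinates, and two of them must both be signs. Taking \<open>j > i\<close> lists each
  pair once.\<close>

lemma lee_sphere_2_eq:
  fixes n :: nat
  defines "A \<equiv> (\<lambda>(i, \<sigma>). unit_vec n i \<sigma>) ` ({1..n} \<times> {1, -1, 2, -2})"
    and "B \<equiv> (\<lambda>((i, j), \<sigma>, \<tau>). unit_vec n i \<sigma> \<otimes>\<^bsub>Zn n\<^esub> unit_vec n j \<tau>) `
             ((SIGMA i:{1..n}. {i+1..n}) \<times> ({1, -1} \<times> {1, -1}))"
  shows "lee_sphere n 2 = insert \<one>\<^bsub>Zn n\<^esub> (A \<union> B)"
proof (intro equalityI subsetI)
  have A_iff: "s \<in> A \<longleftrightarrow> (\<exists>i \<sigma>. (i \<in> {1..n} \<and> \<sigma> \<in> {1, -1, 2, -2}) \<and> s = unit_vec n i \<sigma>)" for s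
    unfolding A_def image_iff Bex_def split_paired_Ex mem_Sigma_iff prod.case ..
  have B_iff: "s \<in> B \<longleftrightarrow> (\<exists>i j \<sigma> \<tau>. ((i \<in> {1..n} \<and> j \<in> {i+1..n}) \<and> \<sigma> \<in> {1, -1} \<and> \<tau> \<in> {1, -1})
      \<and> s = unit_vec n i \<sigma> \<otimes>\<^bsub>Zn n\<^esub> unit_vec n j \<tau>)" for s
    unfolding B_def image_iff Bex_def split_paired_Ex mem_Sigma_iff prod.case ..
  { fix s assume "s \<in> insert \<one>\<^bsub>Zn n\<^esub> (A \<union> B)"
  then consider "s = \<one>\<^bsub>Zn n\<^esub>" | i \<sigma> where "i \<in> {1..n}" "\<bar>\<sigma>\<bar> \<le> 2" "s = unit_vec n i \<sigma>"
    | i j \<sigma> \<tau> where "i \<in> {1..n}" "j \<in> {i+1..n}" "\<bar>\<sigma>\<bar> = 1" "\<bar>\<tau>\<bar> = 1"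
        "s = unit_vec n i \<sigma> \<otimes>\<^bsub>Zn n\<^esub> unit_vec n j \<tau>"
  proof -
    have "\<bar>\<sigma>\<bar> \<le> 2" if "\<sigma> \<in> {1, -1, 2, -2}" for \<sigma> :: int using that by auto
    moreover have "\<bar>\<sigma>\<bar> = 1" if "\<sigma> \<in> {1, -1}" for \<sigma> :: int using that by auto
    ultimately show ?thesis
      using \<open>s \<in> insert _ _\<close> that A_iff B_iff by (elim insertE UnE) metis+
  qed
  then show "s \<in> lee_sphere n 2"
  proof cases
    case 1
    then show ?thesis by (simp add: lee_sphere_def)
  next
    case 2
    have "(\<Sum>k=1..n. \<bar>s k\<bar>) = (\<Sum>k=1..n. if k = i then \<bar>\<sigma>\<bar> else 0)"
      using 2 by (intro sum.cong) (auto simp: unit_vec_def)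
    then show ?thesis using 2 by (auto simp: lee_sphere_def unit_vec_def)
  next
    case 3
    have "(\<Sum>k=1..n. \<bar>s k\<bar>) = (\<Sum>k=1..n. (if k = i then \<bar>\<sigma>\<bar> else 0) + (if k = j then \<bar>\<tau>\<bar> else 0))"
      using 3 by (intro sum.cong) (auto simp: unit_vec_def)
    then show ?thesis using 3 by (auto simp: lee_sphere_def unit_vec_def sum.distrib)
  qed
  }
  fix s assume "s \<in> lee_sphere n 2"
  then have s: "s \<in> extensional {1..n}" and le: "(\<Sum>k=1..n. \<bar>s k\<bar>) \<le> 2"
    by (auto simp: lee_sphere_def PiE_iff)
  have le': "(\<Sum>k\<in>I. \<bar>s k\<bar>) \<le> 2" if "I \<subseteq> {1..n}" for I
    using sum_mono2[of "{1..n}" I "\<lambda>k. \<bar>s k\<bar>"] that le by auto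
  consider "\<forall>k\<in>{1..n}. s k = 0"
    | i where "i \<in> {1..n}" "s i \<noteq> 0" "\<forall>k\<in>{1..n} - {i}. s k = 0"
    | i j where "i \<in> {1..n}" "j \<in> {1..n}" "i < j" "s i \<noteq> 0" "s j \<noteq> 0"
    by (metis DiffE insertI1 linorder_neqE_nat Diff_iff singletonI)
  then show "s \<in> insert \<one>\<^bsub>Zn n\<^esub> (A \<union> B)"
  proof cases
    case 1
    then show ?thesis using s by (auto intro!: extensionalityI[of _ "{1..n}"])
  next
    case 2
    have "\<bar>s i\<bar> \<le> 2" using le'[of "{i}"] 2 by simp
    then have "s i \<in> {1, -1, 2, -2}" using 2(2) by auto
    moreover have "s = unit_vec n i (s i)"
      using s 2 by (intro extensionalityI[of _ "{1..n}"]) (auto simp: unit_vec_def)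
    ultimately have "s \<in> A" using 2(1) A_iff by metis
    then show ?thesis by simp
  next
    case 3
    have "\<bar>s i\<bar> + \<bar>s j\<bar> \<le> 2" using le'[of "{i, j}"] 3 by simp
    then have \<sigma>: "\<bar>s i\<bar> = 1" "\<bar>s j\<bar> = 1" using 3 by auto
    \<comment> \<open>The coordinates \<open>i\<close> and \<open>j\<close> already use up the whole
      norm.\<close>
    have "s k = 0" if "k \<in> {1..n} - {i, j}" for k
      using le'[of "{i, j, k}"] that 3 \<sigma> by simp
    then have "s = unit_vec n i (s i) \<otimes>\<^bsub>Zn n\<^esub> unit_vec n j (s j)"
      using s 3 by (intro extensionalityI[of _ "{1..n}"]) (auto simp: unit_vec_def)
    moreover have "s i \<in> {1, -1}" "s j \<in> {1, -1}" using \<sigma> by auto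
    moreover have "j \<in> {i+1..n}" using 3 by auto
    ultimately have "s \<in> B" using 3(1) B_iff by metis
    then show ?thesis by simp
  qed
qed

text \<open>The support of a point recovers its indices and its values there recover the
  coefficients, so the parametrisation is injective and its three families are disjoint. It serves
  to count the sphere, to compute its power sums and to bound the fibre of 0.\<close>

lemma sum_lee_sphere_2:
  fixes g :: "(nat \<Rightarrow> int) \<Rightarrow> 'a :: comm_monoid_add"
  shows "(\<Sum>s\<in>lee_sphere n 2. g s) = g \<one>\<^bsub>Zn n\<^esub>
    + (\<Sum>i=1..n. \<Sum>\<sigma>\<in>{1, -1, 2, -2}. g (unit_vec n i \<sigma>))
    + (\<Sum>i=1..n. \<Sum>j=i+1..n. \<Sum>\<sigma>\<in>{1, -1}. \<Sum>\<tau>\<in>{1, -1}.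
         g (unit_vec n i \<sigma> \<otimes>\<^bsub>Zn n\<^esub> unit_vec n j \<tau>))"
proof -
  define IA :: "(nat \<times> int) set" where "IA = {1..n} \<times> {1, -1, 2, -2}"
  define IB :: "((nat \<times> nat) \<times> int \<times> int) set"
    where "IB = (SIGMA i:{1..n}. {i+1..n}) \<times> ({1, -1} \<times> {1, -1})"
  define a where "a = (\<lambda>(i, \<sigma>). unit_vec n i \<sigma>)"
  define b where "b = (\<lambda>((i, j), \<sigma>, \<tau>). unit_vec n i \<sigma> \<otimes>\<^bsub>Zn n\<^esub> unit_vec n j \<tau>)"
  have supp_a: "{k\<in>{1..n}. a (i, \<sigma>) k \<noteq> 0} = {i}" "a (i, \<sigma>) i = \<sigma>" if "(i, \<sigma>) \<in> IA" for i \<sigma>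
    using that by (auto simp: a_def IA_def unit_vec_def)
  have supp_b: "{k\<in>{1..n}. b ((i, j), \<sigma>, \<tau>) k \<noteq> 0} = {i, j}" "i < j"
      "b ((i, j), \<sigma>, \<tau>) i = \<sigma>" "b ((i, j), \<sigma>, \<tau>) j = \<tau>"
    if "((i, j), \<sigma>, \<tau>) \<in> IB" for i j \<sigma> \<tau>
    using that by (auto simp: b_def IB_def unit_vec_def)
  have fin: "finite IA" "finite IB" by (auto simp: IA_def IB_def)
  have inj_a: "inj_on a IA"
  proof (rule inj_onI)
    fix p q assume pq: "p \<in> IA" "q \<in> IA" "a p = a q"
    obtain i \<sigma> i' \<sigma>' where [simp]: "p = (i, \<sigma>)" "q = (i', \<sigma>')" by (metis surj_pair)
    have IA: "(i, \<sigma>) \<in> IA" "(i', \<sigma>') \<in> IA" and eq: "a (i, \<sigma>) = a (i', \<sigma>')" using pq by simp_all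
    have "{i} = {i'}" using supp_a(1)[OF IA(1)] supp_a(1)[OF IA(2)] unfolding eq by (rule trans[OF sym])
    then have "i = i'" by simp
    moreover have "\<sigma> = \<sigma>'"
      using supp_a(2)[OF IA(1)] supp_a(2)[OF IA(2)] unfolding eq[unfolded \<open>i = i'\<close>] \<open>i = i'\<close> by (rule trans[OF sym])
    ultimately show "p = q" by simp
  qed
  have inj_b: "inj_on b IB"
  proof (rule inj_onI)
    fix p q assume pq: "p \<in> IB" "q \<in> IB" "b p = b q"
    obtain i j \<sigma> \<tau> i' j' \<sigma>' \<tau>' where [simp]: "p = ((i, j), \<sigma>, \<tau>)" "q = ((i', j'), \<sigma>', \<tau>')"
      by (metis surj_pair)
    have IB: "((i, j), \<sigma>, \<tau>) \<in> IB" "((i', j'), \<sigma>', \<tau>') \<in> IB"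
      and eq: "b ((i, j), \<sigma>, \<tau>) = b ((i', j'), \<sigma>', \<tau>')" using pq by simp_all
    note b = supp_b[OF IB(1), unfolded eq] and b' = supp_b[OF IB(2)]
    have "{i, j} = {i', j'}" using b(1) b'(1) by (rule trans[OF sym])
    then have "i = i' \<and> j = j'" using b(2) b'(2) by (auto simp: doubleton_eq_iff)
    moreover from this have "\<sigma> = \<sigma>'" "\<tau> = \<tau>'" using b(3,4) b'(3,4) by (metis, metis)
    ultimately show "p = q" by simp
  qed
  have disj: "a ` IA \<inter> b ` IB = {}"
  proof -
    have False if "a (i, \<sigma>) = b ((i', j'), \<sigma>', \<tau>')" "(i, \<sigma>) \<in> IA" "((i', j'), \<sigma>', \<tau>') \<in> IB"
      for i \<sigma> i' j' \<sigma>' \<tau>'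
      using that supp_a(1)[of i \<sigma>] supp_b(1,2)[of i' j' \<sigma>' \<tau>'] by auto
    then show ?thesis by auto
  qed
  have one: "\<one>\<^bsub>Zn n\<^esub> \<notin> a ` IA \<union> b ` IB"
  proof -
    have supp: "{k\<in>{1..n}. \<one>\<^bsub>Zn n\<^esub> k \<noteq> 0} = {}" by auto
    have "\<one>\<^bsub>Zn n\<^esub> \<noteq> a (i, \<sigma>)" if "(i, \<sigma>) \<in> IA" for i \<sigma>
    proof
      assume "\<one>\<^bsub>Zn n\<^esub> = a (i, \<sigma>)"
      from supp_a(1)[OF that, folded this, unfolded supp] show False by simp
    qed
    moreover have "\<one>\<^bsub>Zn n\<^esub> \<noteq> b ((i, j), \<sigma>, \<tau>)" if "((i, j), \<sigma>, \<tau>) \<in> IB" for i j \<sigma> \<tau>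
    proof
      assume "\<one>\<^bsub>Zn n\<^esub> = b ((i, j), \<sigma>, \<tau>)"
      from supp_b(1)[OF that, folded this, unfolded supp] show False by simp
    qed
    ultimately show ?thesis unfolding image_iff Un_iff by (metis surj_pair)
  qed
  have "(\<Sum>s\<in>lee_sphere n 2. g s) = (\<Sum>s\<in>insert \<one>\<^bsub>Zn n\<^esub> (a ` IA \<union> b ` IB). g s)"
    by (simp only: lee_sphere_2_eq a_def b_def IA_def IB_def)
  also have "\<dots> = g \<one>\<^bsub>Zn n\<^esub> + (sum g (a ` IA) + sum g (b ` IB))"
    using fin one disj by (simp add: sum.union_disjoint del: Zn_simps)
  also have "sum g (a ` IA) = (\<Sum>p\<in>IA. g (a p))" using inj_a by (simp add: sum.reindex)
  also have "\<dots> = (\<Sum>i=1..n. \<Sum>\<sigma>\<in>{1, -1, 2, -2}. g (unit_vec n i \<sigma>))"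
    unfolding IA_def a_def sum.cartesian_product by (simp only: case_prod_unfold)
  also have "sum g (b ` IB) = (\<Sum>p\<in>IB. g (b p))" using inj_b by (simp add: sum.reindex)
  also have "\<dots> = (\<Sum>(i, j)\<in>(SIGMA i:{1..n}. {i+1..n}). \<Sum>\<sigma>\<in>{1, -1}. \<Sum>\<tau>\<in>{1, -1}.
         g (unit_vec n i \<sigma> \<otimes>\<^bsub>Zn n\<^esub> unit_vec n j \<tau>))"
    unfolding IB_def b_def sum.cartesian_product case_prod_unfold by (simp only: sum.cartesian_product case_prod_unfold)
  also have "\<dots> = (\<Sum>i=1..n. \<Sum>j=i+1..n. \<Sum>\<sigma>\<in>{1, -1}. \<Sum>\<tau>\<in>{1, -1}.
         g (unit_vec n i \<sigma> \<otimes>\<^bsub>Zn n\<^esub> unit_vec n j \<tau>))"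
    by (rule sum.Sigma[symmetric]) auto
  finally show ?thesis by (simp only: add.assoc)
qed

section \<open>Cardinality of the sphere and even power sums over it\<close>

lemma finite_lee_sphere_2: "finite (lee_sphere n 2)"
  unfolding lee_sphere_2_eq by auto

text \<open>This replaces sums over pairs \<open>i < j\<close> by full double sums, which factor
  into products of power sums.\<close>

lemma sum_sum_symmetric:
  fixes h :: "nat \<Rightarrow> nat \<Rightarrow> int"
  assumes "\<And>i j. h i j = h j i"
  shows "(\<Sum>i=1..n. \<Sum>j=1..n. h i j) = (\<Sum>i=1..n. h i i) + 2 * (\<Sum>i=1..n. \<Sum>j=i+1..n. h i j)"
proof (induction n)
  case (Suc n)
  have "(\<Sum>i=1..n. \<Sum>j=i+1..Suc n. h i j) = (\<Sum>i=1..n. (\<Sum>j=i+1..n. h i j) + h i (Suc n))"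
    by (intro sum.cong) auto
  moreover have "(\<Sum>j=1..n. h (Suc n) j) = (\<Sum>j=1..n. h j (Suc n))"
    by (intro sum.cong refl assms)
  ultimately show ?case
    using Suc by (simp add: sum.distrib)
qed simp

lemma card_lee_sphere_2: "card (lee_sphere n 2) = 2 * n^2 + 2 * n + 1"
proof -
  have "int (card (lee_sphere n 2)) = (\<Sum>s\<in>lee_sphere n 2. 1)" by simp
  also have "\<dots> = 1 + 4 * int n + 4 * (\<Sum>i=1..n. \<Sum>j=i+1..n. 1)"
    unfolding sum_lee_sphere_2 by (simp add: sum_distrib_left mult.commute)
  also have "2 * (\<Sum>i=1..n. \<Sum>j=i+1..n. (1::int)) = int n * int n - int n"
    using sum_sum_symmetric[of "\<lambda>_ _. 1" n] by simp
  then have "1 + 4 * int n + 4 * (\<Sum>i=1..n. \<Sum>j=i+1..n. (1::int)) = int (2 * n^2 + 2 * n + 1)"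
    by (simp add: power2_eq_square)
  finally show ?thesis by linarith
qed

text \<open>Flipping the sign of \<open>a\<close> cancels the odd powers and doubles the even ones;
  the other two sign pairs are negatives of these and double again.\<close>

lemma sum_signs_power_even:
  fixes a b :: int
  shows "(\<Sum>\<sigma>\<in>{1, -1}. \<Sum>\<tau>\<in>{1, -1}. (\<sigma> * a + \<tau> * b) ^ (2 * k))
    = 4 * (\<Sum>s\<le>k. int (2 * k choose (2 * s)) * a ^ (2 * s) * b ^ (2 * (k - s)))"
proof -
  let ?t = "\<lambda>i. int (2 * k choose i) * a ^ i * b ^ (2 * k - i)"
  have "(a + b) ^ (2 * k) + (- a + b) ^ (2 * k) = (\<Sum>i\<le>2*k. ?t i + (- 1) ^ i * ?t i)"
    unfolding binomial_ring sum.distrib[symmetric]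
    by (intro sum.cong refl) (simp add: power_minus[of a])
  also have "\<dots> = (\<Sum>i\<in>(\<lambda>s. 2 * s) ` {..k}. 2 * ?t i)"
  proof (intro sum.mono_neutral_cong_right ballI)
    fix i assume "i \<in> {..2 * k} - (\<lambda>s. 2 * s) ` {..k}"
    then have "odd i" by (auto elim!: evenE)
    then show "?t i + (- 1) ^ i * ?t i = 0" by simp
  qed auto
  also have "\<dots> = 2 * (\<Sum>s\<le>k. int (2 * k choose (2 * s)) * a ^ (2 * s) * b ^ (2 * (k - s)))"
    by (subst sum.reindex) (auto simp: inj_on_def sum_distrib_left diff_mult_distrib2)
  finally have *: "(a + b) ^ (2 * k) + (- a + b) ^ (2 * k) = \<dots>" .
  have "(a - b)\<^sup>2 = (- a + b)\<^sup>2" "(- a - b)\<^sup>2 = (a + b)\<^sup>2"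
    by (simp_all add: power2_eq_square algebra_simps)
  then have "(a - b) ^ (2 * k) = (- a + b) ^ (2 * k)" "(- a - b) ^ (2 * k) = (a + b) ^ (2 * k)"
    by (simp_all only: power_mult)
  with * show ?thesis by simp
qed

text \<open>The source of the factor \<open>4 ^ k + 4 n + 2\<close>: it collects the terms \<open>s = 0\<close>, \<open>s = k\<close> of the double sum,
  its diagonal, and the one-coordinate points of the sphere.\<close>

lemma sphere_power_sum:
  fixes x :: "nat \<Rightarrow> int" and n k :: nat
  assumes k: "k > 0"
  defines "S \<equiv> \<lambda>s. \<Sum>i=1..n. x i ^ (2 * s)"
  shows "(\<Sum>i=1..n. \<Sum>\<sigma>\<in>{1, -1, 2, -2}. (\<sigma> * x i) ^ (2 * k))
    + (\<Sum>i=1..n. \<Sum>j=i+1..n. \<Sum>\<sigma>\<in>{1, -1}. \<Sum>\<tau>\<in>{1, -1}. (\<sigma> * x i + \<tau> * x j) ^ (2 * k))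
    = (4 ^ k + 4 * int n + 2) * S k
      + 2 * (\<Sum>s\<in>{0<..<k}. int (2 * k choose (2 * s)) * (S s * S (k - s)))"
proof -
  define h where "h i j = (\<Sum>\<sigma>\<in>{1, -1}. \<Sum>\<tau>\<in>{1, -1}. (\<sigma> * x i + \<tau> * x j) ^ (2 * k))" for i j
  define c where "c s = int (2 * k choose (2 * s)) * (S s * S (k - s))" for s
  have sym: "h i j = h j i" for i j
    unfolding h_def by (subst sum.swap) (simp add: add.commute)
  have "(\<Sum>i=1..n. \<Sum>j=1..n. h i j)
      = (\<Sum>i=1..n. \<Sum>j=1..n. \<Sum>s\<le>k. 4 * int (2 * k choose (2 * s)) * (x i ^ (2 * s) * x j ^ (2 * (k - s))))"
    unfolding h_def sum_signs_power_even by (simp add: sum_distrib_left mult.assoc)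
  also have "\<dots> = (\<Sum>i=1..n. \<Sum>s\<le>k. \<Sum>j=1..n. 4 * int (2 * k choose (2 * s)) * (x i ^ (2 * s) * x j ^ (2 * (k - s))))"
    by (intro sum.cong refl sum.swap)
  also have "\<dots> = (\<Sum>s\<le>k. \<Sum>i=1..n. \<Sum>j=1..n. 4 * int (2 * k choose (2 * s)) * (x i ^ (2 * s) * x j ^ (2 * (k - s))))"
    by (rule sum.swap)
  also have "\<dots> = (\<Sum>s\<le>k. 4 * c s)"
    by (simp only: c_def S_def sum_product) (simp only: sum_distrib_left mult.assoc)
  \<comment> \<open>As \<open>S 0 = n\<close>, each of the two end terms contributes
    \<open>4 * n * S k\<close>.\<close>
  also have "{..k} = insert 0 (insert k {0<..<k})" using k by auto
  also have "(\<Sum>s\<in>\<dots>. 4 * c s) = 8 * int n * S k + 4 * (\<Sum>s\<in>{0<..<k}. c s)"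
    using k by (simp add: sum_distrib_left) (simp add: c_def S_def)
  finally have all: "(\<Sum>i=1..n. \<Sum>j=1..n. h i j) = 8 * int n * S k + 4 * (\<Sum>s\<in>{0<..<k}. c s)" .
  have pow: "(2 * x i) ^ (2 * k) = 4 ^ k * x i ^ (2 * k)" for i
    by (simp add: power_mult_distrib power_mult)
  have "h i i = 2 * 4 ^ k * x i ^ (2 * k)" for i
  proof -
    have "h i i = (x i + x i) ^ (2 * k) + (- x i - x i) ^ (2 * k)"
      using k by (simp add: h_def)
    also have "x i + x i = 2 * x i" by simp
    also have "- x i - x i = - (2 * x i)" by simp
    also have "(- (2 * x i)) ^ (2 * k) = (2 * x i) ^ (2 * k)" by simp
    finally show ?thesis unfolding pow by simp
  qed
  then have "(\<Sum>i=1..n. h i i) = 2 * 4 ^ k * S k"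
    by (simp add: S_def sum_distrib_left)
  \<comment> \<open>Halved, this has coefficient \<open>4 * n - 4 ^ k\<close> at \<open>S k\<close>;
    the one-coordinate points add \<open>2 + 2 * 4 ^ k\<close>.\<close>
  then have 2: "2 * (\<Sum>i=1..n. \<Sum>j=i+1..n. h i j) = 8 * int n * S k + 4 * (\<Sum>s\<in>{0<..<k}. c s) - 2 * 4 ^ k * S k"
    using sum_sum_symmetric[of h n] sym all by simp
  have "(\<Sum>\<sigma>\<in>{1, -1, 2, -2}. (\<sigma> * x i) ^ (2 * k)) = (2 + 2 * 4 ^ k) * x i ^ (2 * k)" for i
  proof -
    have "(- 2 * x i) ^ (2 * k) = 4 ^ k * x i ^ (2 * k)"
      using pow[of i] power_minus_even[where a="2 * x i" and n=k] by simp
    then show ?thesis using pow[of i] by (simp add: distrib_right)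
  qed
  then have 1: "(\<Sum>i=1..n. \<Sum>\<sigma>\<in>{1, -1, 2, -2}. (\<sigma> * x i) ^ (2 * k)) = (2 + 2 * 4 ^ k) * S k"
    by (simp only: S_def sum_distrib_left)
  show ?thesis
    unfolding h_def[symmetric] c_def[symmetric] 1 using 2 by (simp add: algebra_simps)
qed

section \<open>Linear perfect Lee codes\<close>

text \<open>By commutativity the tiling can be read from the other side: covering says that the
  sphere meets every coset of \<open>C\<close>, disjointness that it meets each only once.\<close>

lemma bij_betw_lee_sphere_cosets:
  assumes C: "linear_PL_code n r C"
  shows "bij_betw (\<lambda>s. C #>\<^bsub>Zn n\<^esub> s) (lee_sphere n r) (carrier (Zn n Mod C))"
proof -
  interpret comm_group "Zn n" by (rule Zn_comm_group)
  interpret C: subgroup C "Zn n" using C by (simp add: linear_PL_code_def)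
  have S: "lee_sphere n r \<subseteq> carrier (Zn n)" by (auto simp: lee_sphere_def)
  have part: "partition_on (carrier (Zn n)) ((\<lambda>c. lee_sphere n r #>\<^bsub>Zn n\<^esub> c) ` C)"
    using C by (simp add: linear_PL_code_def)
  have one: "\<one>\<^bsub>Zn n\<^esub> \<in> lee_sphere n r" by (simp add: lee_sphere_def)
  txt \<open>The partition is given as a set of translates, so equal translates must be excluded: otherwise
    all multiples of \<open>c\<close> would lie in the sphere.\<close>
  have translate_eq: "c = \<one>\<^bsub>Zn n\<^esub>"
    if c: "c \<in> C" and eq: "lee_sphere n r #>\<^bsub>Zn n\<^esub> c = lee_sphere n r" for c
  proof -
    have pow: "c [^]\<^bsub>Zn n\<^esub> k \<in> lee_sphere n r" for k :: nat
    proof (induction k)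
      case (Suc k)
      then have "c [^]\<^bsub>Zn n\<^esub> k \<otimes>\<^bsub>Zn n\<^esub> c \<in> lee_sphere n r #>\<^bsub>Zn n\<^esub> c"
        by (auto simp: r_coset_def simp del: Zn_simps)
      then show ?case by (simp add: eq del: Zn_simps)
    qed (use one in \<open>simp del: Zn_simps\<close>)
    have val: "(c [^]\<^bsub>Zn n\<^esub> k) i = int k * c i" if "i \<in> {1..n}" for i and k :: nat
      using that by (induction k) (auto simp: algebra_simps)
    have "c i = 0" if i: "i \<in> {1..n}" for i
    proof -
      \<comment> \<open>The exponent exceeds the radius, so a nonzero integer entry
        \<open>c i\<close> would push this power out of the sphere.\<close>
      have "\<bar>(c [^]\<^bsub>Zn n\<^esub> Suc r) i\<bar> \<le> (\<Sum>j=1..n. \<bar>(c [^]\<^bsub>Zn n\<^esub> Suc r) j\<bar>)"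
        using i by (intro member_le_sum) auto
      also have "\<dots> \<le> int r" using pow[of "Suc r"] by (simp add: lee_sphere_def)
      finally have "int (Suc r) * \<bar>c i\<bar> \<le> int r" unfolding val[OF i] by (simp add: abs_mult)
      then have "int (Suc r) * \<bar>c i\<bar> < int (Suc r) * 1" by (rule order.strict_trans1) simp
      then have "\<not> int (Suc r) * 1 \<le> int (Suc r) * \<bar>c i\<bar>" by (simp only: not_le)
      then have "\<not> 1 \<le> \<bar>c i\<bar>" by (metis mult_left_mono of_nat_0_le_iff)
      then show ?thesis by linarith
    qed
    then show ?thesis
      using C.subset c by (auto intro!: extensionalityI[of _ "{1..n}"] simp: PiE_iff)
  qed
  show ?thesis
    unfolding bij_betw_def
  proof
    show "inj_on (\<lambda>s. C #>\<^bsub>Zn n\<^esub> s) (lee_sphere n r)"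
    proof (rule inj_onI)
      fix s t assume st: "s \<in> lee_sphere n r" "t \<in> lee_sphere n r"
        and eq: "C #>\<^bsub>Zn n\<^esub> s = C #>\<^bsub>Zn n\<^esub> t"
      have "t \<in> C #>\<^bsub>Zn n\<^esub> s" using rcos_self[OF _ C.subgroup_axioms, of t] st S eq by blast
      then obtain c where c: "c \<in> C" "t = c \<otimes>\<^bsub>Zn n\<^esub> s"
        by (auto simp: r_coset_def simp del: Zn_simps)
      then have t: "t = s \<otimes>\<^bsub>Zn n\<^esub> c" using st S C.subset m_comm by blast
      then have "t \<in> lee_sphere n r #>\<^bsub>Zn n\<^esub> c" using st by (auto simp: r_coset_def simp del: Zn_simps)
      moreover have "lee_sphere n r #>\<^bsub>Zn n\<^esub> \<one>\<^bsub>Zn n\<^esub> = lee_sphere n r"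
        using S by (rule coset_mult_one)
      \<comment> \<open>Both translates contain \<open>t\<close>, so disjointness identifies
        them.\<close>
      ultimately have "lee_sphere n r #>\<^bsub>Zn n\<^esub> c = lee_sphere n r"
        using part c(1) st(2) C.one_closed unfolding partition_on_def disjoint_def
        by (metis (no_types, lifting) IntI empty_iff image_eqI)
      then have "c = \<one>\<^bsub>Zn n\<^esub>" using c by (rule_tac translate_eq)
      then show "s = t" using c st S by (auto simp del: Zn_simps)
    qed
    show "(\<lambda>s. C #>\<^bsub>Zn n\<^esub> s) ` lee_sphere n r = carrier (Zn n Mod C)"
    proof (intro equalityI subsetI)
      fix X assume "X \<in> carrier (Zn n Mod C)"
      then obtain g where g: "g \<in> carrier (Zn n)" "X = C #>\<^bsub>Zn n\<^esub> g"
        by (auto simp: carrier_FactGroup simp del: Zn_simps)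
      then have "g \<in> \<Union> ((\<lambda>c. lee_sphere n r #>\<^bsub>Zn n\<^esub> c) ` C)"
        using part unfolding partition_on_def by blast
      then obtain c s where c: "c \<in> C" and s: "s \<in> lee_sphere n r" and "g = s \<otimes>\<^bsub>Zn n\<^esub> c"
        by (auto simp: r_coset_def simp del: Zn_simps)
      then have "g = c \<otimes>\<^bsub>Zn n\<^esub> s" using S C.subset m_comm by blast
      then have "g \<in> C #>\<^bsub>Zn n\<^esub> s" using c by (auto simp: r_coset_def simp del: Zn_simps)
      then have "X = C #>\<^bsub>Zn n\<^esub> s"
        using repr_independence[OF _ _ C.subgroup_axioms] s S g(2) by blast
      then show "X \<in> (\<lambda>s. C #>\<^bsub>Zn n\<^esub> s) ` lee_sphere n r" using s by blast
    qed (use S in \<open>auto simp: carrier_FactGroup simp del: Zn_simps\<close>)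
  qed
qed

text \<open>The map factors through the quotient by \<open>C\<close>. The coset bijection transports
  the kernel count and the vanishing power sums from there to the sphere.\<close>

lemma PL_code_hom:
  assumes C: "linear_PL_code n r C" and fin: "finite (lee_sphere n r)"
    and p: "prime p" and dvd: "p dvd card (lee_sphere n r)"
  obtains f where "f \<in> hom (Zn n) (integer_mod_group p)"
    and "card {s \<in> lee_sphere n r. f s = 0} * p = card (lee_sphere n r)"
    and "\<And>j. j + 1 < p \<Longrightarrow> int p dvd (\<Sum>s\<in>lee_sphere n r. f s ^ j)"
proof -
  interpret comm_group "Zn n" by (rule Zn_comm_group)
  have sub: "subgroup C (Zn n)" using C by (simp add: linear_PL_code_def)
  define Q where "Q = Zn n Mod C"
  interpret Q: comm_group Q unfolding Q_def using sub by (rule abelian_FactGroup)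
  have bij: "bij_betw (\<lambda>s. C #>\<^bsub>Zn n\<^esub> s) (lee_sphere n r) (carrier Q)"
    unfolding Q_def using C by (rule bij_betw_lee_sphere_cosets)
  have finQ: "finite (carrier Q)" using bij fin bij_betw_finite by blast
  have cardQ: "card (carrier Q) = card (lee_sphere n r)" using bij by (metis bij_betw_same_card)
  obtain \<phi> where \<phi>: "\<phi> \<in> hom Q (integer_mod_group p)" "\<phi> ` carrier Q = carrier (integer_mod_group p)"
    using Q.epi_integer_mod_group[OF finQ p] dvd cardQ by (auto simp: order_def)
  interpret \<phi>: group_hom Q "integer_mod_group p" \<phi>
    by (intro group_hom.intro group_hom_axioms.intro Q.is_group group_integer_mod_group \<phi>(1))
  define f where "f s = \<phi> (C #>\<^bsub>Zn n\<^esub> s)" for s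
  have p0: "p > 1" using p by (rule prime_gt_1_nat)
  show ?thesis
  proof (rule that[of f])
    have rcos: "(\<lambda>s. C #>\<^bsub>Zn n\<^esub> s) \<in> hom (Zn n) Q"
      unfolding Q_def using normal.r_coset_hom_Mod subgroup_imp_normal[OF sub] by blast
    show "f \<in> hom (Zn n) (integer_mod_group p)"
    proof (rule homI)
      fix s t assume st: "s \<in> carrier (Zn n)" "t \<in> carrier (Zn n)"
      show "f s \<in> carrier (integer_mod_group p)"
        unfolding f_def by (rule \<phi>.hom_closed) (rule hom_in_carrier[OF rcos st(1)])
      show "f (s \<otimes>\<^bsub>Zn n\<^esub> t) = f s \<otimes>\<^bsub>integer_mod_group p\<^esub> f t"
        unfolding f_def hom_mult[OF rcos st]
        by (rule \<phi>.hom_mult) (use st in \<open>auto intro: hom_in_carrier[OF rcos] simp del: Zn_simps\<close>)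
    qed
  next
    have "bij_betw (\<lambda>s. C #>\<^bsub>Zn n\<^esub> s) {s \<in> lee_sphere n r. f s = 0} {q \<in> carrier Q. \<phi> q = 0}"
    proof -
      have img: "carrier Q = (\<lambda>s. C #>\<^bsub>Zn n\<^esub> s) ` lee_sphere n r" using bij by (simp add: bij_betw_def)
      show ?thesis using bij unfolding img f_def by (auto simp: bij_betw_def inj_on_def)
    qed
    then have "card {s \<in> lee_sphere n r. f s = 0} = card (kernel Q (integer_mod_group p) \<phi>)"
      by (simp add: bij_betw_same_card kernel_def)
    moreover have "order (integer_mod_group p) = p"
      using p0 by (simp add: order_def carrier_integer_mod_group)
    ultimately show "card {s \<in> lee_sphere n r. f s = 0} * p = card (lee_sphere n r)"
      using \<phi>.card_kernel_mult_order[OF \<phi>(2)] cardQ by (simp add: order_def)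
  next
    fix j assume j: "j + 1 < p"
    \<comment> \<open>Translation by a preimage \<open>u\<close> of 1 is the required shift.\<close>
    have "1 \<in> \<phi> ` carrier Q" using p0 \<phi>(2) by simp
    then obtain u where u: "u \<in> carrier Q" "\<phi> u = 1" by auto
    have "int p dvd (\<Sum>q\<in>carrier Q. \<phi> q ^ j)"
    proof (rule prime_dvd_power_sum[OF p finQ _ _ _ j])
      show "bij_betw (\<lambda>q. q \<otimes>\<^bsub>Q\<^esub> u) (carrier Q) (carrier Q)"
        using u Q.inj_on_multc Q.surj_const_mult by (simp add: bij_betw_def) (metis (no_types, lifting) Q.inj_on_cmult Q.m_comm image_cong)
      show "[\<phi> (q \<otimes>\<^bsub>Q\<^esub> u) = \<phi> q + 1] (mod int p)" if "q \<in> carrier Q" for q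
        using that u by (simp add: cong_def)
      show "p dvd card (carrier Q)" using dvd cardQ by simp
    qed
    also have "(\<Sum>q\<in>carrier Q. \<phi> q ^ j) = (\<Sum>s\<in>lee_sphere n r. f s ^ j)"
      unfolding f_def by (rule sum.reindex_bij_betw[OF bij, symmetric])
    finally show "int p dvd (\<Sum>s\<in>lee_sphere n r. f s ^ j)" .
  qed
qed

lemma hom_unit_vec_cong:
  assumes f: "f \<in> hom (Zn n) (integer_mod_group p)"
  shows "[f (unit_vec n i \<sigma>) = \<sigma> * f (unit_vec n i 1)] (mod int p)"
proof -
  define h where "h \<sigma> = f (unit_vec n i \<sigma>)" for \<sigma>
  have add: "[h (\<sigma> + \<tau>) = h \<sigma> + h \<tau>] (mod int p)" for \<sigma> \<tau>
    using hom_mult[OF f unit_vec_carrier unit_vec_carrier, of i \<sigma> i \<tau>]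
    unfolding unit_vec_add h_def by (simp add: cong_def)
  have "[h \<sigma> = \<sigma> * h 1] (mod int p)"
  proof (induction \<sigma> rule: int_induct[where k = 0])
    case base
    have "[h 0 + 0 = h 0 + h 0] (mod int p)" using add[of 0 0] by simp
    then show ?case by (simp only: cong_add_lcancel) (simp add: cong_sym)
  next
    case (step1 \<sigma>)
    from cong_trans[OF add[of \<sigma> 1] cong_add[OF step1(2) cong_refl]]
    show ?case by (simp add: algebra_simps)
  next
    case (step2 \<sigma>)
    have "[h (\<sigma> - 1) + h 1 = \<sigma> * h 1] (mod int p)"
      using cong_trans[OF cong_sym[OF add[of "\<sigma> - 1" 1]]] step2(2) by simp
    from cong_diff[OF this cong_refl[of "h 1"]]
    show ?case by (simp add: algebra_simps)
  qed
  then show ?thesis by (simp add: h_def)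
qed

section \<open>Recursion for the power sums and count of vanishing coordinates\<close>

theorem theorem3:
  fixes n m v b :: nat and a :: enat
  assumes "n > 0" and "m > 0"
    and "2 * n^2 + 2 * n + 1 = m * v"
    and "prime v" and "v > 2 * n + 1"
    and "a = (INF k\<in>{k::nat. k > 0 \<and> v dvd 4 ^ k + 4 * n + 2}. enat k)"
    and "b = ord v 4"
    and "\<exists>C. linear_PL_code n 2 C"
  shows "\<exists>l\<in>{0..m div 4}. \<exists>x y :: nat. a * enat (x + 1) + enat (b * y) = enat (n - l)"
proof -
  define sphere where "sphere = lee_sphere n 2"
  obtain C where C: "linear_PL_code n 2 C" using assms by blast
  have card: "card sphere = m * v" using assms(3) by (simp only: sphere_def card_lee_sphere_2)
  obtain f where f: "f \<in> hom (Zn n) (integer_mod_group v)"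
    and ker: "card {s \<in> sphere. f s = 0} * v = card sphere"
    and pow: "\<And>j. j + 1 < v \<Longrightarrow> int v dvd (\<Sum>s\<in>sphere. f s ^ j)"
  proof (rule PL_code_hom[OF C finite_lee_sphere_2 \<open>prime v\<close>])
    show "v dvd card (lee_sphere n 2)" using card by (simp add: sphere_def)
  qed (rule that, simp_all add: sphere_def)
  have v: "v > 1" "odd v"
    using \<open>prime v\<close> assms(1,5) prime_odd_nat[of v] by (auto simp: prime_gt_1_nat)
  define x where "x i = f (unit_vec n i 1)" for i
  have f_one: "f \<one>\<^bsub>Zn n\<^esub> = 0"
    using hom_one[OF f] Zn_comm_group by (simp add: comm_group.axioms(2) del: Zn_simps)
  \<comment> \<open>Values of \<open>f\<close> are least residues, so congruence to 0 is equality
    with 0.\<close>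
  have f_dvd: "int v dvd f s \<longleftrightarrow> f s = 0" if "s \<in> carrier (Zn n)" for s
  proof -
    have "0 \<le> f s" "f s < int v"
      using hom_in_carrier[OF f that] v by (auto simp: carrier_integer_mod_group)
    then show ?thesis using zdvd_not_zless[of "f s" "int v"] by (metis dvd_0_right order_le_less)
  qed
  have f1: "[f (unit_vec n i \<sigma>) = \<sigma> * x i] (mod int v)" for i \<sigma>
    unfolding x_def using f by (rule hom_unit_vec_cong)
  have f2: "[f (unit_vec n i \<sigma> \<otimes>\<^bsub>Zn n\<^esub> unit_vec n j \<tau>) = \<sigma> * x i + \<tau> * x j] (mod int v)" for i j \<sigma> \<tau>
    using hom_mult[OF f unit_vec_carrier unit_vec_carrier, of i \<sigma> j \<tau>] cong_add[OF f1[of i \<sigma>] f1[of j \<tau>]]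
    by (simp add: cong_def del: Zn_simps)
  define S where "S s = (\<Sum>i=1..n. x i ^ (2 * s))" for s
  have S_rec: "int v dvd (4 ^ k + 4 * int n + 2) * S k
      + 2 * (\<Sum>s\<in>{0<..<k}. int (2 * k choose (2 * s)) * (S s * S (k - s)))"
    if k: "0 < k" "k \<le> n" for k
  proof -
    \<comment> \<open>The summand \<open>0\<close> is the term of the origin, as
      \<open>k > 0\<close>.\<close>
    have "[(\<Sum>s\<in>sphere. f s ^ (2 * k)) = 0
        + (\<Sum>i=1..n. \<Sum>\<sigma>\<in>{1, -1, 2, -2}. (\<sigma> * x i) ^ (2 * k))
        + (\<Sum>i=1..n. \<Sum>j=i+1..n. \<Sum>\<sigma>\<in>{1, -1}. \<Sum>\<tau>\<in>{1, -1}. (\<sigma> * x i + \<tau> * x j) ^ (2 * k))] (mod int v)"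
      unfolding sphere_def sum_lee_sphere_2
      by (intro cong_add cong_sum cong_pow f1 f2) (use k in \<open>simp add: f_one zero_power del: Zn_simps\<close>)
    \<comment> \<open>The exponent is admissible: \<open>k \<le> n\<close> and
      \<open>v > 2 * n + 1\<close> give \<open>2 * k + 1 < v\<close>.\<close>
    moreover have "int v dvd (\<Sum>s\<in>sphere. f s ^ (2 * k))"
      using pow[of "2 * k"] k assms(5) by simp
    ultimately show ?thesis
      unfolding S_def using cong_dvd_iff by (simp only: add_0 sphere_power_sum[OF k(1)]) blast
  qed
  \<comment> \<open>Unless \<open>v\<close> divides the factor of \<open>S k\<close> in
    \<open>S_rec\<close>, some product \<open>S s * S (k - s)\<close> must be nonzero modulo
    \<open>v\<close>, and \<open>k\<close> is a sum of two smaller generated degrees.\<close>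
  have R: "lee_generated a b k" if "0 < k" "k \<le> n" "\<not> int v dvd S k" for k
    using that
  proof (induction k rule: less_induct)
    case (less k)
    show ?case
    proof (cases "v dvd 4 ^ k + 4 * n + 2")
      case True
      then show ?thesis using lee_generated_if_dvd[OF v(2) less.prems(1)] assms(6,7) by simp
    next
      case False
      have "int v dvd 4 ^ k + 4 * int n + 2 \<longleftrightarrow> int v dvd int (4 ^ k + 4 * n + 2)" by (simp add: add.commute)
      then have "\<not> int v dvd 4 ^ k + 4 * int n + 2" using False unfolding int_dvd_int_iff by blast
      then have "\<not> int v dvd (4 ^ k + 4 * int n + 2) * S k"
        using \<open>prime v\<close> less.prems by (simp add: prime_dvd_mult_iff)
      then have "\<not> int v dvd 2 * (\<Sum>s\<in>{0<..<k}. int (2 * k choose (2 * s)) * (S s * S (k - s)))"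
        using S_rec[OF less.prems(1,2)] dvd_add_left_iff by blast
      then have "\<not> int v dvd (\<Sum>s\<in>{0<..<k}. int (2 * k choose (2 * s)) * (S s * S (k - s)))"
        using dvd_mult by blast
      then obtain s where s: "s \<in> {0<..<k}" "\<not> int v dvd int (2 * k choose (2 * s)) * (S s * S (k - s))"
        by (meson dvd_sum)
      then have "\<not> int v dvd S s" "\<not> int v dvd S (k - s)" by auto
      then show ?thesis
        using less.IH[of s] less.IH[of "k - s"] s less.prems lee_generated_add[of a b s "k - s"] by simp
    qed
  qed
  define l where "l = card {i\<in>{1..n}. x i = 0}"
  have "1 + 4 * l \<le> card {s \<in> sphere. f s = 0}"
  proof -
    define g :: "(nat \<Rightarrow> int) \<Rightarrow> nat" where "g s = of_bool (f s = 0)" for s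
    have "g (unit_vec n i \<sigma>) = 1" if "x i = 0" for i \<sigma>
    proof -
      have "int v dvd f (unit_vec n i \<sigma>)" using f1[of i \<sigma>] that by (simp add: cong_0_iff)
      then show ?thesis by (simp add: f_dvd[OF unit_vec_carrier] g_def del: Zn_simps)
    qed
    then have g: "4 * of_bool (x i = 0) \<le> (\<Sum>\<sigma>\<in>{1, -1, 2, -2}. g (unit_vec n i \<sigma>))" for i
      by simp
    have "1 + 4 * l = 1 + (\<Sum>i=1..n. 4 * of_bool (x i = 0))"
      by (simp add: l_def sum_distrib_left[symmetric] sum.If_cases of_bool_def Int_def conj_commute)
    also have "\<dots> \<le> g \<one>\<^bsub>Zn n\<^esub> + (\<Sum>i=1..n. \<Sum>\<sigma>\<in>{1, -1, 2, -2}. g (unit_vec n i \<sigma>))"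
      by (intro add_mono sum_mono g) (simp add: g_def f_one del: Zn_simps)
    also have "\<dots> \<le> (\<Sum>s\<in>sphere. g s)"
      unfolding sphere_def sum_lee_sphere_2 by simp
    also have "\<dots> = card {s \<in> sphere. f s = 0}"
      using finite_lee_sphere_2[of n]
      by (simp add: g_def sphere_def sum.If_cases of_bool_def Int_def conj_commute)
    finally show ?thesis .
  qed
  also have "card {s \<in> sphere. f s = 0} = m" using ker card v by simp
  finally have l: "1 + 4 * l \<le> m" .
  \<comment> \<open>Squaring turns \<open>S k\<close> into the ordinary power sum of degree
    \<open>k\<close> and, \<open>v\<close> being prime, keeps the same zeros.\<close>
  define y where "y i = (x i)\<^sup>2" for i
  have "card {i\<in>{1..n}. y i \<noteq> 0} = card ({1..n} - {i\<in>{1..n}. x i = 0})"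
    by (rule arg_cong[of _ _ card]) (auto simp: y_def)
  also have "\<dots> = n - l" unfolding l_def by (subst card_Diff_subset) auto
  finally have card_y: "card {i\<in>{1..n}. y i \<noteq> 0} = n - l" .
  \<comment> \<open>This makes the degree \<open>n - l\<close> positive. Otherwise
    \<open>m \<ge> 1 + 4 * n\<close>, and \<open>m * v\<close> would exceed the size of the
    sphere.\<close>
  have "l < n"
  proof (rule ccontr)
    assume "\<not> l < n"
    then have "(1 + 4 * n) * (2 * n + 1) \<le> m * v" using l assms(5) by (intro mult_mono) auto
    then show False using assms(1,3) by (simp add: algebra_simps power2_eq_square)
  qed
  have "lee_generated a b (card {i\<in>{1..n}. y i \<noteq> 0})"
  proof (rule card_nonzero_of_power_sums[OF \<open>prime v\<close>])
    show "lee_generated a b k" if "0 < k" "k \<le> card {1..n}" "\<not> int v dvd (\<Sum>i=1..n. y i ^ k)" for k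
      using R[of k] that by (simp add: S_def y_def power_mult)
    show "int v dvd y i \<longleftrightarrow> y i = 0" for i
    proof -
      have "int v dvd y i \<longleftrightarrow> int v dvd x i"
        using \<open>prime v\<close> by (simp add: y_def prime_dvd_power_iff)
      also have "\<dots> \<longleftrightarrow> x i = 0"
        unfolding x_def by (rule f_dvd[OF unit_vec_carrier])
      finally show ?thesis by (simp add: y_def)
    qed
    show "{i\<in>{1..n}. y i \<noteq> 0} \<noteq> {}" using card_y \<open>l < n\<close> by (metis card.empty zero_less_diff less_numeral_extra(3))
  qed (use assms(5) in \<open>auto intro: lee_generated_add\<close>)
  then have "lee_generated a b (n - l)" using card_y by simp
  moreover have "l \<in> {0..m div 4}" using l by simp
  ultimately show ?thesis unfolding lee_generated_def by blast
qed

end
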